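(* Let $\Delta\geq 4$ be an integer. If $G$ is a connected bipartite graph of maximum degree at most $\Delta$ that is distinct from (i.e. not isomorphic to) $K_{\Delta,\Delta}$, then $\chi'_{ur}(G)\leq \Delta^2-\Delta$.
   Context: All graphs are finite, simple, and undirected. A matching in a graph $G$ is a set of pairwise non-adjacent edges of $G$; for a matching $M$, $V(M)$ denotes the set of vertices incident with an edge in $M$. A matching $M$ in $G$ is uniquely restricted if there is no matching $M'$ in $G$ with $M'\neq M$ and $V(M')=V(M)$. The uniquely restricted chromatic index $\chi'_{ur}(G)$ is the minimum number of uniquely restricted matchings in $G$ into which the edge set $E(G)$ can be partitioned. $K_{\Delta,\Delta}$ is the complete bipartite graph with both partite sets of size $\Delta$. *)

theory Defs
  imports Main "HOL-Library.Disjoint_Sets"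
begin

definition simple_graph :: "'a set \<Rightarrow> 'a set set \<Rightarrow> bool" where
  "simple_graph V E \<longleftrightarrow> finite V \<and> (\<forall>e\<in>E. e \<subseteq> V \<and> card e = 2)"

definition connected_graph :: "'a set \<Rightarrow> 'a set set \<Rightarrow> bool" where
  "connected_graph V E \<longleftrightarrow> V \<noteq> {} \<and> (\<forall>u\<in>V. \<forall>v\<in>V. (u, v) \<in> {(x, y). {x, y} \<in> E}\<^sup>*)"

definition bipartite_graph :: "'a set \<Rightarrow> 'a set set \<Rightarrow> bool" where
  "bipartite_graph V E \<longleftrightarrow>
     (\<exists>A B. A \<union> B = V \<and> A \<inter> B = {} \<and> (\<forall>e\<in>E. \<exists>a\<in>A. \<exists>b\<in>B. e = {a, b}))"

definition vertex_degree :: "'a set set \<Rightarrow> 'a \<Rightarrow> nat" where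
  "vertex_degree E v = card {e \<in> E. v \<in> e}"

(* Meaningful only for finite nonempty V. *)
definition max_degree :: "'a set \<Rightarrow> 'a set set \<Rightarrow> nat" where
  "max_degree V E = Max (vertex_degree E ` V)"

definition graph_isomorphic ::
    "'a set \<Rightarrow> 'a set set \<Rightarrow> 'b set \<Rightarrow> 'b set set \<Rightarrow> bool" where
  "graph_isomorphic V E V' E' \<longleftrightarrow>
     (\<exists>f. bij_betw f V V' \<and> (\<forall>u\<in>V. \<forall>v\<in>V. {u, v} \<in> E \<longleftrightarrow> {f u, f v} \<in> E'))"

definition complete_bipartite_verts :: "nat \<Rightarrow> nat \<Rightarrow> (nat + nat) set" where
  "complete_bipartite_verts m n = {..<m} <+> {..<n}"

definition complete_bipartite_edges :: "nat \<Rightarrow> nat \<Rightarrow> (nat + nat) set set" where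
  "complete_bipartite_edges m n = {{Inl i, Inr j} | i j. i < m \<and> j < n}"

definition matching :: "'a set set \<Rightarrow> 'a set set \<Rightarrow> bool" where
  "matching E M \<longleftrightarrow> M \<subseteq> E \<and> pairwise disjnt M"

(* The set V(M) of vertices covered by M is the union of its edges. *)
definition uniquely_restricted :: "'a set set \<Rightarrow> 'a set set \<Rightarrow> bool" where
  "uniquely_restricted E M \<longleftrightarrow>
     matching E M \<and> \<not> (\<exists>M'. matching E M' \<and> M' \<noteq> M \<and> \<Union>M' = \<Union>M)"

(* For a finite simple graph the minimum exists, since the partition of E into
   singletons consists of uniquely restricted matchings. *)
definition ur_chromatic_index :: "'a set set \<Rightarrow> nat" where
  "ur_chromatic_index E =
     (LEAST k. \<exists>P. partition_on E P \<and> finite P \<and> card P = k \<and>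
                   (\<forall>M\<in>P. uniquely_restricted E M))"

end

theory Submission
  imports Defs
begin

text \<open>
  The edges of a bipartite graph of maximum degree at most \<open>\<Delta>\<close> split into \<open>\<Delta>\<close> matchings (Koenig's
  theorem), so it suffices to split every matching \<open>M\<close> into \<open>\<Delta> - 1\<close> uniquely restricted ones.
  Write the edges of \<open>M\<close> as pairs \<open>(a, b)\<close> with \<open>a\<close> in one side and \<open>b\<close> in the other, and draw an arc
  from \<open>(a, b)\<close> to \<open>(a', b')\<close> if \<open>a\<close> is adjacent to \<open>b'\<close>. A part of \<open>M\<close> is uniquely restricted
  when it induces an acyclic digraph, because another matching on the same vertices would yield a
  directed cycle (\<open>acyclic_imp_uniquely_restricted\<close>). In this digraph all in-degrees and
  out-degrees are at most \<open>\<Delta> - 1\<close>, and a complete digraph on \<open>\<Delta>\<close> vertices in it is a subgraph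
  \<open>K\<^bsub>\<Delta>,\<Delta>\<^esub>\<close>, which by connectedness is the whole graph. Hence the directed version of Brooks'
  theorem with \<open>k = \<Delta> - 1 \<ge> 3\<close> splits \<open>M\<close> into \<open>\<Delta> - 1\<close> acyclic parts (\<open>split_matching\<close>),
  and \<open>\<Delta> (\<Delta> - 1)\<close> matchings suffice in total.
  
  The directed theorem (\<open>directed_brooks\<close>) is reduced to the undirected one (\<open>brooks\<close>). Arrange the vertices so that as
  few pairs as possible carry a backward arc. As any vertex could be moved to the very front or the very
  back, each has at most as many backward neighbours as it has in-neighbours or out-neighbours, so the
  graph of backward pairs has maximum degree at most \<open>k\<close>, and a proper colouring of it leaves
  only forward arcs within a colour class. A complete graph on \<open>k + 1\<close> vertices among the backward pairs
  is destroyed by moving one of its vertices, unless the digraph itself is complete there.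
\<close>

section \<open>Brooks' theorem\<close>

definition proper_coloring :: "('v \<Rightarrow> 'v \<Rightarrow> bool) \<Rightarrow> nat \<Rightarrow> 'v set \<Rightarrow> ('v \<Rightarrow> nat) \<Rightarrow> bool" where
  "proper_coloring adj k W c \<longleftrightarrow> (\<forall>u\<in>W. c u < k \<and> (\<forall>v\<in>W. adj u v \<longrightarrow> c u \<noteq> c v))"

definition clique :: "('v \<Rightarrow> 'v \<Rightarrow> bool) \<Rightarrow> 'v set \<Rightarrow> bool" where
  "clique adj Q \<longleftrightarrow> (\<forall>u\<in>Q. \<forall>v\<in>Q. u \<noteq> v \<longrightarrow> adj u v)"

text \<open>
  The bound counts colours, not neighbours, so that a vertex with two equally coloured
  neighbours can still be coloured when it has \<open>k\<close> neighbours in total.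
\<close>

lemma proper_coloring_extend:
  assumes "symp adj" "irreflp adj" "finite W" "proper_coloring adj k W c"
    and few: "card (c ` {u \<in> W. adj v u}) < k"
    and "v \<notin> W"
  shows "\<exists>d. proper_coloring adj k (insert v W) d \<and> (\<forall>u\<in>W. d u = c u)"
proof -
  have "\<not> {..<k} \<subseteq> c ` {u \<in> W. adj v u}"
    using few card_mono[of "c ` {u \<in> W. adj v u}" "{..<k}"] \<open>finite W\<close> by auto
  then obtain i where i: "i < k" "i \<notin> c ` {u \<in> W. adj v u}" by blast
  have "proper_coloring adj k (insert v W) (c(v := i))"
    using assms i unfolding proper_coloring_def
    by (auto dest: sympD irreflpD) 
  then show ?thesis using \<open>v \<notin> W\<close> by (intro exI[of _ "c(v := i)"]) auto
qed

text \<open>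
  A list is a good order for greedy colouring when every entry still has a neighbour that is
  coloured after it, either later in the list or the root \<open>r\<close>, which stays uncoloured: then at
  most \<open>k - 1\<close> neighbours are coloured when the turn of that entry comes.
\<close>

primrec feeds :: "('v \<Rightarrow> 'v \<Rightarrow> bool) \<Rightarrow> 'v \<Rightarrow> 'v list \<Rightarrow> bool" where
  "feeds adj r [] \<longleftrightarrow> True"
| "feeds adj r (x # xs) \<longleftrightarrow> (\<exists>y\<in>insert r (set xs). adj x y) \<and> feeds adj r xs"

lemma feeds_path: "successively adj (xs @ [r]) \<Longrightarrow> feeds adj r xs"
proof (induction xs)
  case (Cons x xs)
  then show ?case by (cases xs) auto
qed simp

lemma feeds_append:
  assumes "successively adj (xs @ [z])" "z \<in> set ys" "feeds adj r ys"
  shows "feeds adj r (xs @ ys)"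
  using assms
proof (induction xs)
  case (Cons x xs)
  then show ?case by (cases xs) auto
qed simp

lemma greedy_coloring:
  assumes "symp adj" "irreflp adj" "finite V"
    and deg: "\<And>v. v \<in> V \<Longrightarrow> card {u \<in> V. adj v u} \<le> k"
    and "proper_coloring adj k W c" "W \<subseteq> V" "set xs \<subseteq> V" "distinct xs" "set xs \<inter> W = {}"
    and "r \<in> V" "r \<notin> W" "r \<notin> set xs" "feeds adj r xs"
  shows "\<exists>d. proper_coloring adj k (W \<union> set xs) d \<and> (\<forall>u\<in>W. d u = c u)"
  using assms(5-)
proof (induction xs arbitrary: W c)
  case Nil
  then show ?case by auto
next
  case (Cons x xs)
  obtain y where y: "y \<in> insert r (set xs)" "adj x y" using Cons.prems by auto
  have "y \<in> V" "y \<notin> W" using y Cons.prems by auto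
  have "finite W" using Cons.prems(2) \<open>finite V\<close> finite_subset by blast
  have "{u \<in> W. adj x u} \<subset> {u \<in> V. adj x u}"
    using y \<open>y \<in> V\<close> \<open>y \<notin> W\<close> Cons.prems(2) by auto
  then have "card {u \<in> W. adj x u} < card {u \<in> V. adj x u}"
    using \<open>finite V\<close> by (intro psubset_card_mono) auto
  also have "\<dots> \<le> k" using deg Cons.prems by auto
  finally have few: "card (c ` {u \<in> W. adj x u}) < k"
    using card_image_le[of "{u \<in> W. adj x u}" c] \<open>finite W\<close> by auto
  have "x \<notin> W" using Cons.prems by auto
  then obtain d where d: "proper_coloring adj k (insert x W) d" "\<forall>u\<in>W. d u = c u"
    using proper_coloring_extend[OF assms(1,2) \<open>finite W\<close> Cons.prems(1) few] by blast
  obtain e where "proper_coloring adj k (insert x W \<union> set xs) e" "\<forall>u\<in>insert x W. e u = d u"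
    using Cons.IH[OF d(1)] Cons.prems by auto
  then show ?case using d by (intro exI[of _ e]) auto
qed

text \<open>
  The root left over by greedy colouring can be coloured once two of its neighbours agree,
  since its at most \<open>k\<close> neighbours then show at most \<open>k - 1\<close> colours.
\<close>

lemma close_coloring:
  assumes "symp adj" "irreflp adj" "finite V"
    and "card {u \<in> V. adj v u} \<le> k" "v \<in> V"
    and c: "proper_coloring adj k (V - {v}) c"
    and "x \<in> V" "y \<in> V" "x \<noteq> y" "adj v x" "adj v y" "c x = c y"
  shows "\<exists>d. proper_coloring adj k V d"
proof -
  have *: "{u \<in> V - {v}. adj v u} = {u \<in> V. adj v u}"
    using \<open>irreflp adj\<close> by (auto dest: irreflpD)
  have fin: "finite {u \<in> V. adj v u}" using \<open>finite V\<close> by simp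
  have "c ` {u \<in> V. adj v u} = c ` ({u \<in> V. adj v u} - {x})"
    using assms by (auto simp: image_iff)
  also have "card \<dots> \<le> card ({u \<in> V. adj v u} - {x})"
    using fin by (intro card_image_le) auto
  also have "\<dots> < card {u \<in> V. adj v u}"
    using fin assms by (intro psubset_card_mono) auto
  finally have "card (c ` {u \<in> V - {v}. adj v u}) < k" using * assms(4) by simp
  then have "\<exists>d. proper_coloring adj k (insert v (V - {v})) d"
    using proper_coloring_extend[OF assms(1,2) _ c, of v] \<open>finite V\<close> by auto
  then show ?thesis using \<open>v \<in> V\<close> by (simp add: insert_absorb)
qed

text \<open>
  Only the far end of the path is extended, so a prescribed beginning \<open>p\<close> survives.
\<close>

lemma maximal_path_extension:
  assumes "finite V" "symp adj" "set p \<subseteq> V" "distinct p" "successively adj p" "p \<noteq> []"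
  shows "\<exists>q. set (p @ q) \<subseteq> V \<and> distinct (p @ q) \<and> successively adj (p @ q) \<and>
             {u \<in> V. adj (last (p @ q)) u} \<subseteq> set (p @ q)"
proof -
  define P where "P q \<longleftrightarrow> set (p @ q) \<subseteq> V \<and> distinct (p @ q) \<and> successively adj (p @ q)" for q
  have "P []" using assms by (simp add: P_def)
  moreover have "length q < Suc (card V)" if "P q" for q
  proof -
    have "length (p @ q) = card (set (p @ q))" using that unfolding P_def
      by (metis distinct_card)
    also have "\<dots> \<le> card V" using that \<open>finite V\<close> unfolding P_def by (metis card_mono)
    finally show ?thesis by simp
  qed
  ultimately obtain q where q: "P q" "\<And>q'. P q' \<Longrightarrow> length q' \<le> length q"
    using ex_has_greatest_nat[of P "[]" length "Suc (card V)"] by auto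
  have "u \<in> set (p @ q)" if "u \<in> V" "adj (last (p @ q)) u" for u
  proof (rule ccontr)
    assume "u \<notin> set (p @ q)"
    then have "P (q @ [u])" using q(1) that \<open>p \<noteq> []\<close> unfolding P_def
      using successively_append_iff[of adj "p @ q" "[u]"] by auto
    from q(2)[OF this] show False by simp
  qed
  then show ?thesis using q(1) unfolding P_def by blast
qed

text \<open>
  The cycle has consecutive vertices \<open>y\<close> and \<open>w\<close> such that all neighbours of \<open>y\<close> lie on the
  cycle, while \<open>w\<close> has a neighbour \<open>x\<close> outside. No coloured vertex constrains \<open>y\<close>, so it may
  copy the colour of \<open>x\<close>. Greedy colouring along the cycle from the other neighbour of \<open>y\<close> round
  to \<open>w\<close> then leaves \<open>w\<close> with two equally coloured neighbours.
\<close>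

lemma color_cycle:
  assumes "symp adj" "irreflp adj" "finite V"
    and deg: "\<And>v. v \<in> V \<Longrightarrow> card {u \<in> V. adj v u} \<le> k"
    and cyc: "set (w # m @ [y]) \<subseteq> V" "distinct (w # m @ [y])" "successively adj (w # m @ [y])" "adj w y"
    and c: "proper_coloring adj k (V - set (w # m @ [y])) c"
    and y: "{u \<in> V. adj y u} \<subseteq> set (w # m @ [y])"
    and x: "x \<in> V" "x \<notin> set (w # m @ [y])" "adj w x"
  shows "\<exists>d. proper_coloring adj k V d"
proof -
  let ?W = "V - set (w # m @ [y])"
  have 1: "proper_coloring adj k (insert y ?W) (c(y := c x))"
    using c y x \<open>irreflp adj\<close> \<open>symp adj\<close> unfolding proper_coloring_def
    by (auto dest: irreflpD sympD)
  have conv: "conversep adj = adj" using \<open>symp adj\<close> by (simp add: symp_conv_conversep_eq)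
  have "successively adj (w # m)"
    using cyc(3) successively_append_iff[of adj "w # m" "[y]"] by simp
  then have "successively adj (rev (w # m))" unfolding successively_rev
    using \<open>symp adj\<close> by (auto elim!: successively_mono dest: sympD)
  then have "feeds adj w (rev m)" by (intro feeds_path) simp
  then obtain d where d: "proper_coloring adj k (insert y ?W \<union> set (rev m)) d"
      "\<forall>u\<in>insert y ?W. d u = (c(y := c x)) u"
    using greedy_coloring[OF assms(1-3) deg 1, of "rev m" w] cyc by auto
  have "insert y ?W \<union> set (rev m) = V - {w}" using cyc by auto
  with d(1) have "proper_coloring adj k (V - {w}) d" by simp
  moreover have "d x = d y" using d(2) x by auto
  ultimately show ?thesis
    using close_coloring[OF assms(1-3) deg, of w d x y] x cyc by auto
qed

text \<open>
  Give \<open>x\<close> and \<open>y\<close> the same colour and keep their common neighbour \<open>v\<close> for the end. A third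
  neighbour \<open>z\<close> of \<open>v\<close> makes the rest of the path feed into \<open>v\<close>: the vertices before \<open>z\<close> are
  coloured in path order, those from the far end back to \<open>z\<close> in reverse.
\<close>

lemma color_hamiltonian_path:
  assumes "symp adj" "irreflp adj" "finite V"
    and deg: "\<And>v. v \<in> V \<Longrightarrow> card {u \<in> V. adj v u} \<le> k"
    and "3 \<le> card {u \<in> V. adj v u}"
    and V: "V = set ([x, v, y] @ q)" and "distinct ([x, v, y] @ q)" "successively adj ([x, v, y] @ q)"
    and "\<not> adj x y" "0 < k"
  shows "\<exists>d. proper_coloring adj k V d"
proof -
  have 1: "proper_coloring adj k {x, y} (\<lambda>_. 0)"
    using assms unfolding proper_coloring_def by (auto dest: irreflpD sympD)
  have "\<not> {u \<in> V. adj v u} \<subseteq> {x, y}"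
  proof
    assume "{u \<in> V. adj v u} \<subseteq> {x, y}"
    then have "card {u \<in> V. adj v u} \<le> card {x, y}" by (intro card_mono) auto
    also have "\<dots> \<le> 2" by (simp add: card_insert_if)
    finally show False using assms(5) by simp
  qed
  then obtain z where z: "z \<in> V" "adj v z" "z \<noteq> x" "z \<noteq> y" by auto
  moreover have "z \<noteq> v" using z \<open>irreflp adj\<close> by (auto dest: irreflpD)
  ultimately have "z \<in> set q" using V by auto
  then obtain q1 q2 where q: "q = q1 @ z # q2" by (meson split_list)
  have "successively adj (q1 @ z # q2)"
    using assms(8) q successively_append_iff[of adj "[x, v, y]" q] by auto
  then have s1: "successively adj (q1 @ [z])" and "successively adj (z # q2)"
    by (auto simp: successively_append_iff)
  then have "successively adj (rev (z # q2))" unfolding successively_rev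
    using \<open>symp adj\<close> by (auto elim!: successively_mono dest: sympD)
  then have "successively adj (rev (z # q2) @ [v])"
    using z \<open>symp adj\<close> by (auto simp: successively_append_iff dest: sympD)
  then have "feeds adj v (rev (z # q2))" by (rule feeds_path)
  then have "feeds adj v (q1 @ rev (z # q2))" by (intro feeds_append[OF s1]) auto
  then obtain d where d: "proper_coloring adj k ({x, y} \<union> set (q1 @ rev (z # q2))) d"
      "\<forall>u\<in>{x, y}. d u = 0"
    using greedy_coloring[OF assms(1-3) deg 1, of "q1 @ rev (z # q2)" v] assms(7) q V by auto
  have "{x, y} \<union> set (q1 @ rev (z # q2)) = V - {v}" using assms(7) q V by auto
  with d(1) have "proper_coloring adj k (V - {v}) d" by simp
  moreover have "adj v x" "adj v y" "x \<noteq> y"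
    using assms(7,8) \<open>symp adj\<close> by (auto dest: sympD)
  ultimately show ?thesis
    using close_coloring[OF assms(1-3) deg, of v d x y] V d(2) by auto
qed

text \<open>
  Zajac's argument. In a smallest counterexample every vertex has degree exactly \<open>k\<close>, so
  some \<open>v\<close> has non-adjacent neighbours \<open>x\<close> and \<open>y\<close>. Extend the path \<open>x, v, y\<close> until all
  neighbours of its end \<open>l\<close> lie on it; the first of these neighbours closes a cycle \<open>C\<close> that
  contains all neighbours of \<open>l\<close>. Either some vertex of \<open>C\<close> has a neighbour outside \<open>C\<close>, and
  \<open>color_cycle\<close> applies, or no edge leaves \<open>C\<close>. In the latter case
  \<open>C\<close> and its complement are coloured separately unless \<open>C\<close> is everything, and then the path
  is Hamiltonian.
\<close>

theorem brooks:
  fixes V :: "'v set"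
  assumes "finite V" "symp adj" "irreflp adj" "k \<ge> 3"
    and "\<And>v. v \<in> V \<Longrightarrow> card {u \<in> V. adj v u} \<le> k"
    and "\<And>Q. Q \<subseteq> V \<Longrightarrow> card Q = k + 1 \<Longrightarrow> \<not> clique adj Q"
  shows "\<exists>c. proper_coloring adj k V c"
  using assms(1,5,6)
proof (induction V rule: finite_psubset_induct)
  case (psubset V)
  note deg = psubset.prems(1) and no_clique = psubset.prems(2)
  have sub: "\<exists>c. proper_coloring adj k U c" if "U \<subset> V" for U
  proof (rule psubset.IH[OF that])
    show "card {u \<in> U. adj v u} \<le> k" if "v \<in> U" for v
    proof -
      have "card {u \<in> U. adj v u} \<le> card {u \<in> V. adj v u}"
        using \<open>U \<subset> V\<close> psubset.hyps by (intro card_mono) auto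
      then show ?thesis using deg[of v] that \<open>U \<subset> V\<close> by auto
    qed
  qed (use no_clique that in blast)
  show ?case
  proof (cases "V = {}")
    case True
    then show ?thesis by (simp add: proper_coloring_def)
  next
    case False
    show ?thesis
    proof (cases "\<exists>v\<in>V. card {u \<in> V. adj v u} < k")
      case True
      then obtain v where v: "v \<in> V" "card {u \<in> V. adj v u} < k" by blast
      obtain c where c: "proper_coloring adj k (V - {v}) c" using sub[of "V - {v}"] v by blast
      have "card (c ` {u \<in> V - {v}. adj v u}) \<le> card {u \<in> V - {v}. adj v u}"
        using psubset.hyps by (intro card_image_le) auto
      also have "\<dots> \<le> card {u \<in> V. adj v u}" using psubset.hyps by (intro card_mono) auto
      finally have "\<exists>d. proper_coloring adj k (insert v (V - {v})) d"
        using proper_coloring_extend[OF assms(2,3) _ c, of v] v psubset.hyps by auto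
      then show ?thesis using v by (simp add: insert_absorb)
    next
      case False
      then have reg: "card {u \<in> V. adj v u} = k" if "v \<in> V" for v
        using deg[OF that] that by force
      obtain v where v: "v \<in> V" using \<open>V \<noteq> {}\<close> by blast
      have "card (insert v {u \<in> V. adj v u}) = k + 1"
        using reg[OF v] psubset.hyps \<open>irreflp adj\<close> by (simp add: irreflpD)
      then have "\<not> clique adj (insert v {u \<in> V. adj v u})" using no_clique v by auto
      then obtain x y where xy: "x \<in> V" "y \<in> V" "adj v x" "adj v y" "x \<noteq> y" "\<not> adj x y"
        using \<open>symp adj\<close> unfolding clique_def by (auto dest: sympD)
      have "x \<noteq> v" "y \<noteq> v" using xy \<open>irreflp adj\<close> by (auto dest: irreflpD)
      then obtain q where q: "set ([x, v, y] @ q) \<subseteq> V" "distinct ([x, v, y] @ q)"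
          "successively adj ([x, v, y] @ q)"
          "{u \<in> V. adj (last ([x, v, y] @ q)) u} \<subseteq> set ([x, v, y] @ q)"
        using maximal_path_extension[OF psubset.hyps \<open>symp adj\<close>, of "[x, v, y]"] xy v
          \<open>symp adj\<close> by (auto dest: sympD)
      define p where "p = [x, v, y] @ q"
      define l where "l = last p"
      note q = q[folded p_def, folded l_def]
      have "p \<noteq> []" by (simp add: p_def)
      then have "l \<in> V" using q(1) unfolding l_def by (meson last_in_set subsetD)
      have "{u \<in> V. adj l u} \<noteq> {}" using reg[OF \<open>l \<in> V\<close>] \<open>k \<ge> 3\<close>
        by (metis card.empty not_numeral_le_zero)
      then have "\<exists>h\<in>set p. adj l h" using q(4) by blast
      then obtain p1 h zs where p: "p = p1 @ h # zs" "adj l h" "\<forall>u\<in>set p1. \<not> adj l u"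
        by (rule split_list_first_propE)
      define C where "C = h # zs"
      have C: "set C \<subseteq> V" "distinct C" "successively adj C" "last C = l" "C \<noteq> []"
        using q p by (auto simp: C_def l_def successively_append_iff)
      have psub: "V - set C \<subset> V" using C(1) by (auto simp: C_def)
      have lC: "{u \<in> V. adj l u} \<subseteq> set C" using q(4) p unfolding C_def by auto
      show ?thesis
      proof (cases "\<exists>w\<in>set C. \<exists>x\<in>V - set C. adj w x")
        case True
        \<comment> \<open>The first vertex of the cycle with a neighbour outside; its cyclic predecessor is called t below.\<close>
        then obtain ys w ws where w: "C = ys @ w # ws" "\<exists>x\<in>V - set C. adj w x"
            "\<forall>u\<in>set ys. \<not> (\<exists>x\<in>V - set C. adj u x)"
          by (rule split_list_first_propE)
        have "ws @ ys \<noteq> []" using w(1,2) lC C(4) by auto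
        then obtain m t where mt: "ws @ ys = m @ [t]" by (metis append_butlast_last_id)
        have st: "set C = set (w # m @ [t])" unfolding w(1) mt[symmetric] by auto
        have "distinct (w # m @ [t])" unfolding mt[symmetric] using C(2) w(1) by auto
        moreover have "successively adj (w # ws @ ys) \<and> adj w t"
        proof (cases "ys = []")
          case True
          then have "w = h" "t = l" using w(1) C(4) mt by (auto simp: C_def)
          then show ?thesis using True w(1) C(3) p(2) \<open>symp adj\<close> by (auto dest: sympD)
        next
          case False
          then have 1: "hd ys = h" "t = last ys" using w(1) mt
            by (auto simp: C_def hd_append2 dest: arg_cong[of _ _ hd] arg_cong[of _ _ last])
          have "last (w # ws) = l" using w(1) C(4) by simp
          moreover have "successively adj ys" "successively adj (w # ws)" "adj t w"
            using C(3) w(1) False 1 by (simp_all add: successively_append_iff)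
          ultimately have "successively adj ((w # ws) @ ys)" "adj t w"
            using 1 p(2) by (simp_all only: successively_append_iff simp_thms)
          then show ?thesis using \<open>symp adj\<close> by (auto dest: sympD)
        qed
        moreover have "{u \<in> V. adj t u} \<subseteq> set C"
        proof (cases "ys = []")
          case True
          then have "t = l" using w(1) C(4) mt by auto
          then show ?thesis using lC by simp
        next
          case False
          then have "t \<in> set ys" using mt by (metis last_appendR last_in_set last_snoc)
          then show ?thesis using w(3) by blast
        qed
        moreover obtain x where "x \<in> V" "x \<notin> set C" "adj w x" using w(2) by blast
        moreover obtain c where "proper_coloring adj k (V - set C) c"
          using sub[OF psub] by blast
        ultimately show ?thesis
          using color_cycle[OF assms(2,3) psubset.hyps deg, of w m t c x] C(1) st mt by simp
      next
        case False
        show ?thesis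
        proof (cases "set C = V")
          case True
          have "set p1 \<subseteq> set C" using q(1) unfolding True p(1) by simp
          moreover have "set p1 \<inter> set C = {}" using q(2) unfolding C_def p(1) by auto
          ultimately have "set p1 = {}" by (simp only: inf.absorb1)
          then have "set p = set C" unfolding C_def p(1) by simp
          then have "set p = V" unfolding True .
          then have V': "V = set ([x, v, y] @ q)" unfolding p_def by (rule sym)
          have "3 \<le> card {u \<in> V. adj v u}" "0 < k" using reg[OF v] \<open>k \<ge> 3\<close> by linarith+
          then show ?thesis
            by (intro color_hamiltonian_path[OF assms(2,3) psubset.hyps deg _ V' q(2,3)[unfolded p_def] xy(6)])
        next
          case False2: False
          then obtain c where c: "proper_coloring adj k (set C) c" using sub[of "set C"] C(1) by blast
          obtain d where d: "proper_coloring adj k (V - set C) d"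
            using sub[OF psub] by blast
          have "adj v u" if "adj u v" for u v using \<open>symp adj\<close> that by (rule sympD)
          then have separated: "\<not> adj u v \<and> \<not> adj v u" if "u \<in> set C" "v \<in> V" "v \<notin> set C" for u v
            using False that by blast
          have "proper_coloring adj k V (\<lambda>u. if u \<in> set C then c u else d u)"
            using c d separated unfolding proper_coloring_def by simp
          then show ?thesis by blast
        qed
      qed
    qed
  qed
qed

section \<open>Brooks' theorem for digraphs\<close>

text \<open>
  The undirected graph of the arcs that do not strictly increase the position \<open>p\<close>. Both
  directions of a pair of opposite arcs cannot increase, so such pairs always belong to it.
  Positions may coincide, and only their comparison matters; taking them in \<open>int\<close> leaves room
  before and after any finite set.
\<close>

definition back_adj :: "('v \<Rightarrow> 'v \<Rightarrow> bool) \<Rightarrow> ('v \<Rightarrow> int) \<Rightarrow> 'v \<Rightarrow> 'v \<Rightarrow> bool" where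
  "back_adj arc p u v \<longleftrightarrow> u \<noteq> v \<and> (arc u v \<and> p v \<le> p u \<or> arc v u \<and> p u \<le> p v)"

definition back_pairs :: "'v set \<Rightarrow> ('v \<Rightarrow> 'v \<Rightarrow> bool) \<Rightarrow> ('v \<Rightarrow> int) \<Rightarrow> nat" where
  "back_pairs V arc p = card {(u, v) \<in> V \<times> V. back_adj arc p u v}"

lemma symp_back_adj: "symp (back_adj arc p)"
  by (rule sympI) (auto simp: back_adj_def)

lemma irreflp_back_adj: "irreflp (back_adj arc p)"
  by (rule irreflpI) (auto simp: back_adj_def)

lemma back_adj_fun_upd_other:
  "u \<noteq> v \<Longrightarrow> w \<noteq> v \<Longrightarrow> back_adj arc (p(v := i)) u w \<longleftrightarrow> back_adj arc p u w"
  by (simp add: back_adj_def)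

lemma back_pairs_split:
  assumes "finite V" "v \<in> V"
  shows "back_pairs V arc p =
     card {(u, w) \<in> (V - {v}) \<times> (V - {v}). back_adj arc p u w} + 2 * card {u \<in> V. back_adj arc p v u}"
proof -
  let ?A = "{(u, w) \<in> (V - {v}) \<times> (V - {v}). back_adj arc p u w}"
  let ?N = "{u \<in> V. back_adj arc p v u}"
  have "{(u, w) \<in> V \<times> V. back_adj arc p u w} = ?A \<union> (Pair v ` ?N \<union> (\<lambda>u. (u, v)) ` ?N)"
    using \<open>v \<in> V\<close> by (auto simp: back_adj_def)
  moreover have "card (?A \<union> (Pair v ` ?N \<union> (\<lambda>u. (u, v)) ` ?N)) = card ?A + card (Pair v ` ?N \<union> (\<lambda>u. (u, v)) ` ?N)"
    by (rule card_Un_disjoint) (use \<open>finite V\<close> in \<open>auto intro: finite_subset[of _ "V \<times> V"]\<close>)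
  moreover have "card (Pair v ` ?N \<union> (\<lambda>u. (u, v)) ` ?N) = card (Pair v ` ?N) + card ((\<lambda>u. (u, v)) ` ?N)"
    by (rule card_Un_disjoint) (use \<open>finite V\<close> in \<open>auto simp: back_adj_def\<close>)
  moreover have "card (Pair v ` ?N) = card ?N" "card ((\<lambda>u. (u, v)) ` ?N) = card ?N"
    by (rule card_image, simp add: inj_on_def)+
  ultimately show ?thesis unfolding back_pairs_def by simp
qed

lemma back_pairs_fun_upd:
  assumes "finite V" "v \<in> V"
  shows "back_pairs V arc (p(v := i)) + 2 * card {u \<in> V. back_adj arc p v u} =
         back_pairs V arc p + 2 * card {u \<in> V. back_adj arc (p(v := i)) v u}"
proof -
  have "{(u, w) \<in> (V - {v}) \<times> (V - {v}). back_adj arc (p(v := i)) u w} =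
        {(u, w) \<in> (V - {v}) \<times> (V - {v}). back_adj arc p u w}"
    by (auto simp: back_adj_fun_upd_other)
  then show ?thesis
    using back_pairs_split[OF assms, of arc p] back_pairs_split[OF assms, of arc "p(v := i)"] by simp
qed

lemma move_first:
  assumes "finite V"
  obtains i where "{u \<in> V. back_adj arc (p(v := i)) v u} = {u \<in> V. u \<noteq> v \<and> arc u v}"
proof -
  define i where "i = Min (insert 0 (p ` V)) - 1"
  have "i < p u" if "u \<in> V" for u
  proof -
    have "Min (insert 0 (p ` V)) \<le> p u"
      by (rule Min_le) (use that assms in auto)
    then show ?thesis by (simp add: i_def)
  qed
  then have "{u \<in> V. back_adj arc (p(v := i)) v u} = {u \<in> V. u \<noteq> v \<and> arc u v}"
    by (force simp: back_adj_def)
  then show ?thesis using that by blast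
qed

lemma move_last:
  assumes "finite V"
  obtains i where "{u \<in> V. back_adj arc (p(v := i)) v u} = {u \<in> V. u \<noteq> v \<and> arc v u}"
proof -
  define i where "i = Max (insert 0 (p ` V)) + 1"
  have "p u < i" if "u \<in> V" for u
  proof -
    have "p u \<le> Max (insert 0 (p ` V))"
      by (rule Max_ge) (use that assms in auto)
    then show ?thesis by (simp add: i_def)
  qed
  then have "{u \<in> V. back_adj arc (p(v := i)) v u} = {u \<in> V. u \<noteq> v \<and> arc v u}"
    by (force simp: back_adj_def)
  then show ?thesis using that by blast
qed

definition big_cliques :: "'v set \<Rightarrow> ('v \<Rightarrow> 'v \<Rightarrow> bool) \<Rightarrow> nat \<Rightarrow> ('v \<Rightarrow> int) \<Rightarrow> 'v set set" where
  "big_cliques V arc k p = {Q. Q \<subseteq> V \<and> card Q = k + 1 \<and> clique (back_adj arc p) Q}"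

text \<open>
  Moving \<open>v\<close> behind all other vertices turns its backward neighbours into exactly its
  out-neighbours and leaves all other pairs alone; an optimal \<open>p\<close> cannot be improved in this way.
\<close>

lemma optimal_degree:
  assumes "finite V" and opt: "\<And>q. back_pairs V arc p \<le> back_pairs V arc q"
    and "v \<in> V"
  shows "card {u \<in> V. back_adj arc p v u} \<le> card {u \<in> V. u \<noteq> v \<and> arc v u}"
proof -
  have *: "card {u \<in> V. back_adj arc p v u} \<le> card {u \<in> V. back_adj arc (p(v := i)) v u}" for i
    using back_pairs_fun_upd[OF assms(1,3), of arc p i] opt[of "p(v := i)"] by linarith
  show "card {u \<in> V. back_adj arc p v u} \<le> card {u \<in> V. u \<noteq> v \<and> arc v u}"
    using move_last[OF assms(1), of arc p v] * by metis
qed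

lemma big_clique_neighbours:
  assumes "finite V" "Q \<in> big_cliques V arc k p" "v \<in> Q"
    and "card {u \<in> V. back_adj arc p v u} \<le> k"
  shows "{u \<in> V. back_adj arc p v u} = Q - {v}"
proof -
  have Q: "Q \<subseteq> V" "card Q = k + 1" "clique (back_adj arc p) Q"
    using assms(2) by (auto simp: big_cliques_def)
  have "Q - {v} \<subseteq> {u \<in> V. back_adj arc p v u}"
    using Q \<open>v \<in> Q\<close> unfolding clique_def by auto
  moreover have "card (Q - {v}) = k" using Q \<open>v \<in> Q\<close> by simp
  ultimately show ?thesis
    using assms(1,4) card_seteq[of "{u \<in> V. back_adj arc p v u}" "Q - {v}"] by simp
qed

text \<open>
  A vertex \<open>v\<close> of a clique \<open>Q\<close> on \<open>k + 1\<close> vertices is moved to a place where its backward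
  neighbourhood \<open>S\<close> has at most \<open>k\<close> vertices, meets \<open>Q\<close>, but is not \<open>Q - {v}\<close>. Optimality is kept, so
  all backward degrees are still at most \<open>k\<close>. A new clique on \<open>k + 1\<close> vertices would
  contain \<open>v\<close> and a vertex \<open>w\<close> of \<open>S \<inter> Q\<close>; but \<open>w\<close> keeps its neighbours in \<open>Q - {v, w}\<close> and
  has no room for others, so the new clique would be \<open>Q\<close> again, contrary to the choice of \<open>S\<close>.
\<close>

lemma move_breaks_clique:
  assumes fin: "finite V" and opt: "\<And>q. back_pairs V arc p \<le> back_pairs V arc q"
    and deg: "\<And>v. v \<in> V \<Longrightarrow> card {u \<in> V. u \<noteq> v \<and> arc v u} \<le> k"
    and Q: "Q \<in> big_cliques V arc k p" and v: "v \<in> Q"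
    and S: "{u \<in> V. back_adj arc (p(v := i)) v u} = S" "card S \<le> k" "S \<inter> Q \<noteq> {}" "S \<noteq> Q - {v}"
  shows "back_pairs V arc (p(v := i)) = back_pairs V arc p"
    and "big_cliques V arc k (p(v := i)) \<subset> big_cliques V arc k p"
proof -
  let ?q = "p(v := i)"
  have QV: "Q \<subseteq> V" "card Q = k + 1" "finite Q" using Q fin finite_subset by (auto simp: big_cliques_def)
  have "v \<in> V" using v QV by auto
  have le: "card {u \<in> V. back_adj arc p' x u} \<le> k"
    if "back_pairs V arc p' = back_pairs V arc p" "x \<in> V" for p' x
  proof -
    have "card {u \<in> V. back_adj arc p' x u} \<le> card {u \<in> V. u \<noteq> x \<and> arc x u}"
      by (rule optimal_degree[OF fin _ that(2)]) (simp only: that(1) opt)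
    then show ?thesis using deg[OF that(2)] by linarith
  qed
  have "card {u \<in> V. back_adj arc p v u} = k"
    using big_clique_neighbours[OF fin Q v le] \<open>v \<in> V\<close> QV v by simp
  then show same: "back_pairs V arc ?q = back_pairs V arc p"
    using back_pairs_fun_upd[OF fin \<open>v \<in> V\<close>, of arc p i, unfolded S(1)] S(2) opt[of ?q] by linarith
  have not_v: "v \<notin> Q'" if Q': "Q' \<in> big_cliques V arc k ?q" for Q'
  proof
    assume "v \<in> Q'"
    have "{u \<in> V. back_adj arc ?q v u} = Q' - {v}"
      using big_clique_neighbours[OF fin Q' \<open>v \<in> Q'\<close> le] same \<open>v \<in> V\<close> by simp
    then have S': "S = Q' - {v}" using S by simp
    then obtain w where w: "w \<in> Q" "w \<in> Q'" "w \<noteq> v" using S by auto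
    have "w \<in> V" using w QV by auto
    have "{u \<in> V. back_adj arc ?q w u} = Q' - {w}"
      using big_clique_neighbours[OF fin Q' w(2) le] same \<open>w \<in> V\<close> by simp
    moreover have "back_adj arc ?q w u" if "u \<in> Q" "u \<noteq> v" "u \<noteq> w" for u
      using that w Q unfolding big_cliques_def clique_def by (simp add: back_adj_fun_upd_other)
    ultimately have "u \<in> Q'" if "u \<in> Q" for u
      using that w \<open>v \<in> Q'\<close> QV(1) by (cases "u = v \<or> u = w") auto
    then have "Q \<subseteq> Q'" by (rule subsetI)
    moreover have "card Q' = k + 1" "finite Q'" using Q' fin finite_subset by (auto simp: big_cliques_def)
    ultimately have "Q = Q'" using QV by (metis card_subset_eq)
    then show False using S S' by simp
  qed
  have "Q' \<in> big_cliques V arc k p" if Q': "Q' \<in> big_cliques V arc k ?q" for Q'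
  proof -
    have "back_adj arc ?q u w \<longleftrightarrow> back_adj arc p u w" if "u \<in> Q'" "w \<in> Q'" for u w
      using not_v[OF Q'] that by (intro back_adj_fun_upd_other) auto
    then show ?thesis using Q' unfolding big_cliques_def clique_def by simp
  qed
  moreover have "Q \<notin> big_cliques V arc k ?q" using not_v v by blast
  ultimately show "big_cliques V arc k ?q \<subset> big_cliques V arc k p" using Q by blast
qed

text \<open>
  If a vertex that sends (or receives) one arc inside \<open>Q\<close> sends (or receives) all of them, then a
  missing arc from \<open>u\<close> to \<open>v\<close> propagates through a third vertex \<open>w\<close> to a contradiction.
\<close>

lemma complete_of_all_or_nothing:
  assumes fin: "finite Q" "card Q \<ge> 3"
    and tour: "\<And>u v. u \<in> Q \<Longrightarrow> v \<in> Q \<Longrightarrow> u \<noteq> v \<Longrightarrow> arc u v \<or> arc v u"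
    and out_all: "\<And>u v w. \<lbrakk>u \<in> Q; v \<in> Q; w \<in> Q; u \<noteq> v; u \<noteq> w; arc u v\<rbrakk> \<Longrightarrow> arc u w"
    and in_all: "\<And>u v w. \<lbrakk>u \<in> Q; v \<in> Q; w \<in> Q; u \<noteq> v; u \<noteq> w; arc v u\<rbrakk> \<Longrightarrow> arc w u"
  shows "clique arc Q"
  unfolding clique_def
proof (intro ballI impI)
  fix u v assume uv: "u \<in> Q" "v \<in> Q" "u \<noteq> v"
  have "card (Q - {u, v}) \<noteq> 0" using assms(1,2) uv by (simp add: card_Diff_subset)
  then obtain w where w: "w \<in> Q" "w \<noteq> u" "w \<noteq> v" by (metis DiffE card.empty ex_in_conv insertCI)
  show "arc u v"
  proof (rule ccontr)
    assume "\<not> arc u v"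
    then have "arc v u" using tour uv by blast
    then have "arc v w" using out_all[of v u w] uv w by blast
    then have "arc u w" using in_all[of w v u] uv w by blast
    then show False using out_all[of u w v] uv w \<open>\<not> arc u v\<close> by blast
  qed
qed

text \<open>
  Brooks' theorem for digraphs, in the form that every colour class has only arcs which increase
  a common position \<open>p\<close>; in particular every class is acyclic. The reduction to the undirected
  theorem chooses \<open>p\<close> with the fewest backward pairs and, among those, with the fewest backward
  cliques on \<open>k + 1\<close> vertices. Optimality bounds the backward degrees by \<open>k\<close>. If a clique \<open>Q\<close> were left,
  then no vertex of it could be moved to the front or to the back with profit, so that inside \<open>Q\<close>
  each vertex sends all arcs or none and receives all or none, which makes \<open>Q\<close> complete in the
  digraph.
\<close>

theorem directed_brooks:
  fixes V :: "'v set"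
  assumes fin: "finite V" and "k \<ge> 3"
    and outdeg: "\<And>v. v \<in> V \<Longrightarrow> card {u \<in> V. u \<noteq> v \<and> arc v u} \<le> k"
    and indeg: "\<And>v. v \<in> V \<Longrightarrow> card {u \<in> V. u \<noteq> v \<and> arc u v} \<le> k"
    and no_clique: "\<And>Q. Q \<subseteq> V \<Longrightarrow> card Q = k + 1 \<Longrightarrow> \<not> clique arc Q"
  obtains c :: "'v \<Rightarrow> nat" and p :: "'v \<Rightarrow> int" where
    "\<And>v. v \<in> V \<Longrightarrow> c v < k"
    "\<And>u v. \<lbrakk>u \<in> V; v \<in> V; u \<noteq> v; arc u v; c u = c v\<rbrakk> \<Longrightarrow> p u < p v"
proof -
  obtain p0 where p0: "\<And>q. back_pairs V arc p0 \<le> back_pairs V arc q"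
    using ex_has_least_nat[of "\<lambda>_. True" _ "back_pairs V arc"] by auto
  obtain p where p: "back_pairs V arc p = back_pairs V arc p0"
      and least: "\<And>q. back_pairs V arc q = back_pairs V arc p0 \<Longrightarrow>
                    card (big_cliques V arc k p) \<le> card (big_cliques V arc k q)"
    using ex_has_least_nat[of "\<lambda>p. back_pairs V arc p = back_pairs V arc p0" p0
        "\<lambda>p. card (big_cliques V arc k p)"] by auto
  have opt: "back_pairs V arc p \<le> back_pairs V arc q" for q using p p0 by simp
  have deg: "card {u \<in> V. back_adj arc p v u} \<le> k" if "v \<in> V" for v
    using optimal_degree[OF fin opt that] outdeg[OF that] by linarith
  have "Q \<notin> big_cliques V arc k p" for Q
  proof
    assume Q: "Q \<in> big_cliques V arc k p"
    then have QV: "Q \<subseteq> V" "card Q = k + 1" "clique (back_adj arc p) Q" "finite Q"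
      using fin finite_subset by (auto simp: big_cliques_def)
    have stuck: "S \<inter> Q = {} \<or> S = Q - {v}"
      if "v \<in> Q" "{u \<in> V. back_adj arc (p(v := i)) v u} = S" "card S \<le> k" for v i S
    proof (rule ccontr)
      assume "\<not> ?thesis"
      then have "S \<inter> Q \<noteq> {}" "S \<noteq> Q - {v}" by auto
      note mv = move_breaks_clique[OF fin opt outdeg Q that this]
      have "finite (big_cliques V arc k p)" using fin by (simp add: big_cliques_def)
      then have "card (big_cliques V arc k (p(v := i))) < card (big_cliques V arc k p)"
        using mv(2) by (rule psubset_card_mono)
      then show False using least[of "p(v := i)"] mv(1) p by simp
    qed
    have "{u \<in> V. u \<noteq> v \<and> arc v u} \<inter> Q = {} \<or> {u \<in> V. u \<noteq> v \<and> arc v u} = Q - {v}" if v: "v \<in> Q" for v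
    proof -
      have "v \<in> V" using v QV(1) by (rule rev_subsetD)
      show ?thesis using move_last[OF fin, of arc p v] stuck[OF v _ outdeg[OF \<open>v \<in> V\<close>]] by blast
    qed
    then have out: "arc u w" if "u \<in> Q" "v \<in> Q" "w \<in> Q" "u \<noteq> v" "u \<noteq> w" "arc u v" for u v w
      using that QV(1) by blast
    have "{u \<in> V. u \<noteq> v \<and> arc u v} \<inter> Q = {} \<or> {u \<in> V. u \<noteq> v \<and> arc u v} = Q - {v}" if v: "v \<in> Q" for v
    proof -
      have "v \<in> V" using v QV(1) by (rule rev_subsetD)
      show ?thesis using move_first[OF fin, of arc p v] stuck[OF v _ indeg[OF \<open>v \<in> V\<close>]] by blast
    qed
    then have inn: "arc w u" if "u \<in> Q" "v \<in> Q" "w \<in> Q" "u \<noteq> v" "u \<noteq> w" "arc v u" for u v w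
      using that QV(1) by blast
    have "clique arc Q"
    proof (rule complete_of_all_or_nothing[OF QV(4) _ _ out inn])
      show "arc u v \<or> arc v u" if "u \<in> Q" "v \<in> Q" "u \<noteq> v" for u v
        using that QV(3) unfolding clique_def back_adj_def by blast
    qed (use QV \<open>k \<ge> 3\<close> in auto)
    then show False using no_clique QV by blast
  qed
  then obtain c where c: "proper_coloring (back_adj arc p) k V c"
    using brooks[OF fin symp_back_adj irreflp_back_adj \<open>k \<ge> 3\<close> deg] by (auto simp: big_cliques_def)
  show ?thesis
  proof (rule that[of c p])
    show "c v < k" if "v \<in> V" for v using c that unfolding proper_coloring_def by blast
    show "p u < p v" if "u \<in> V" "v \<in> V" "u \<noteq> v" "arc u v" "c u = c v" for u v
      using c that unfolding proper_coloring_def back_adj_def by (metis not_le)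
  qed
qed

section \<open>Edge colourings of bipartite graphs\<close>

definition line_proper :: "('a \<times> 'b) set \<Rightarrow> nat \<Rightarrow> ('a \<times> 'b \<Rightarrow> nat) \<Rightarrow> bool" where
  "line_proper R n c \<longleftrightarrow> (\<forall>a b. (a, b) \<in> R \<longrightarrow> c (a, b) < n \<and>
     (\<forall>b'. (a, b') \<in> R \<longrightarrow> c (a, b) = c (a, b') \<longrightarrow> b = b') \<and>
     (\<forall>a'. (a', b) \<in> R \<longrightarrow> c (a, b) = c (a', b) \<longrightarrow> a = a'))"

text \<open>
  The vertices on the left that can be reached from \<open>a0\<close> by alternating paths which leave the
  left side along colour \<open>\<beta>\<close> and return along colour \<open>\<alpha>\<close>. Orienting the two colours in this way
  makes it possible to argue with a closed set instead of a Kempe chain as an explicit path.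
\<close>

inductive_set alternating_reach ::
    "('a \<times> 'b) set \<Rightarrow> ('a \<times> 'b \<Rightarrow> nat) \<Rightarrow> nat \<Rightarrow> nat \<Rightarrow> 'a \<Rightarrow> 'a set"
  for R c \<alpha> \<beta> a0 where
  base: "a0 \<in> alternating_reach R c \<alpha> \<beta> a0"
| step: "\<lbrakk>a \<in> alternating_reach R c \<alpha> \<beta> a0; (a, b) \<in> R; c (a, b) = \<beta>; (a', b) \<in> R; c (a', b) = \<alpha>\<rbrakk>
    \<Longrightarrow> a' \<in> alternating_reach R c \<alpha> \<beta> a0"

text \<open>
  Exchange \<open>\<alpha>\<close> and \<open>\<beta>\<close> on all edges that leave the set reached from \<open>a0\<close>. Since \<open>\<alpha>\<close> is missing at
  \<open>a0\<close>, at each vertex on the right that carries both colours either both edges are exchanged or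
  neither is. As \<open>\<beta>\<close> is missing at \<open>b0\<close>, the paths never enter \<open>b0\<close>, and \<open>\<beta>\<close> stays missing there.
\<close>

lemma kempe_swap:
  assumes c: "line_proper R n c" and "\<alpha> < n" "\<beta> < n"
    and a0: "\<And>b. (a0, b) \<in> R \<Longrightarrow> c (a0, b) \<noteq> \<alpha>"
    and b0: "\<And>a. (a, b0) \<in> R \<Longrightarrow> c (a, b0) \<noteq> \<beta>"
  shows "\<exists>d. line_proper R n d \<and> (\<forall>b. (a0, b) \<in> R \<longrightarrow> d (a0, b) \<noteq> \<beta>) \<and>
             (\<forall>a. (a, b0) \<in> R \<longrightarrow> d (a, b0) \<noteq> \<beta>)"
proof -
  define X where "X = alternating_reach R c \<alpha> \<beta> a0"
  define s where "s i = (if i = \<alpha> then \<beta> else if i = \<beta> then \<alpha> else i)" for i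
  define d where "d r = (if fst r \<in> X then s (c r) else c r)" for r
  have s_inj: "s i = s j \<longleftrightarrow> i = j" for i j by (auto simp: s_def)
  have s_lt: "s i < n \<longleftrightarrow> i < n" for i using assms(2,3) by (auto simp: s_def)
  have row: "b = b'" if "(a, b) \<in> R" "(a, b') \<in> R" "c (a, b) = c (a, b')" for a b b'
    using c that unfolding line_proper_def by blast
  have col: "a = a'" if "(a, b) \<in> R" "(a', b) \<in> R" "c (a, b) = c (a', b)" for a a' b
    using c that unfolding line_proper_def by blast
  have fwd: "a' \<in> X" if "a \<in> X" "(a, b) \<in> R" "c (a, b) = \<beta>" "(a', b) \<in> R" "c (a', b) = \<alpha>" for a a' b
    using that unfolding X_def by (rule alternating_reach.step)
  have bwd: "\<exists>a\<in>X. (a, b) \<in> R \<and> c (a, b) = \<beta>" if "a' \<in> X" "(a', b) \<in> R" "c (a', b) = \<alpha>" for a' b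
  proof -
    have "a' \<in> alternating_reach R c \<alpha> \<beta> a0" using that(1) by (simp add: X_def)
    then show ?thesis
    proof cases
      case base
      then show ?thesis using that a0 by auto
    next
      case (step a b')
      then have "b = b'" using row[of a' b b'] that by simp
      then show ?thesis using step X_def by blast
    qed
  qed
  have mixed: "a = a'" if ab: "(a, b) \<in> R" "(a', b) \<in> R" "a \<in> X" "a' \<notin> X" "s (c (a, b)) = c (a', b)" for a a' b
  proof -
    consider "c (a, b) = \<alpha>" | "c (a, b) = \<beta>" "c (a, b) \<noteq> \<alpha>" | "c (a, b) \<noteq> \<alpha>" "c (a, b) \<noteq> \<beta>" by blast
    then show ?thesis
    proof cases
      case 1
      then obtain e where "e \<in> X" "(e, b) \<in> R" "c (e, b) = \<beta>" using bwd ab by blast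
      moreover have "c (a', b) = \<beta>" using 1 that by (simp add: s_def)
      ultimately have "a' = e" using col that(2) by metis
      then show ?thesis using \<open>e \<in> X\<close> that by blast
    next
      case 2
      then have "c (a', b) = \<alpha>" using that by (simp add: s_def)
      then show ?thesis using fwd[of a b a'] that 2 by blast
    next
      case 3
      then show ?thesis using that col by (simp add: s_def)
    qed
  qed
  have "line_proper R n d" unfolding line_proper_def
  proof (intro allI impI conjI)
    fix a b assume ab: "(a, b) \<in> R"
    have "c (a, b) < n" using c ab unfolding line_proper_def by blast
    then show "d (a, b) < n" by (simp add: d_def s_lt)
    show "b = b'" if "(a, b') \<in> R" "d (a, b) = d (a, b')" for b'
      using that row[OF ab that(1)] by (simp add: d_def s_inj split: if_splits)
    show "a = a'" if a': "(a', b) \<in> R" and eq: "d (a, b) = d (a', b)" for a'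
    proof (cases "a \<in> X \<longleftrightarrow> a' \<in> X")
      case True
      then have "c (a, b) = c (a', b)" using eq s_inj by (cases "a \<in> X") (simp_all add: d_def)
      then show ?thesis by (rule col[OF ab a'])
    next
      case False
      then consider "a \<in> X" "a' \<notin> X" | "a \<notin> X" "a' \<in> X" by blast
      then show ?thesis
      proof cases
        case 1
        then show ?thesis using mixed[OF ab a'] eq by (simp add: d_def)
      next
        case 2
        then show ?thesis using mixed[OF a' ab] eq by (simp add: d_def)
      qed
    qed
  qed
  moreover have "d (a0, b) \<noteq> \<beta>" if "(a0, b) \<in> R" for b
    using a0[OF that] alternating_reach.base[of a0 R c \<alpha> \<beta>]
    by (auto simp: d_def s_def X_def split: if_splits)
  moreover have "d (a, b0) \<noteq> \<beta>" if "(a, b0) \<in> R" for a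
    using b0[OF that] bwd[of a b0] b0 that
    by (auto simp: d_def s_def split: if_splits)
  ultimately show ?thesis by blast
qed

text \<open>
  Edges are inserted one at a time. A new edge finds a colour \<open>\<alpha>\<close> missing at its first end and a
  colour \<open>\<beta>\<close> missing at its second end; after the exchange \<open>\<beta>\<close> is missing at both.
\<close>

theorem koenig_edge_coloring:
  assumes "finite R"
    and "\<And>a. card {b. (a, b) \<in> R} \<le> n" and "\<And>b. card {a. (a, b) \<in> R} \<le> n"
  shows "\<exists>c. line_proper R n c"
  using assms
proof (induction R rule: finite_induct)
  case empty
  then show ?case by (simp add: line_proper_def)
next
  case (insert r R)
  obtain a0 b0 where r: "r = (a0, b0)" by force
  have finB: "finite {b. (a, b) \<in> insert r R}" for a
    by (rule finite_subset[of _ "snd ` insert r R"]) (use insert.hyps in force)+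
  have finA: "finite {a. (a, b) \<in> insert r R}" for b
    by (rule finite_subset[of _ "fst ` insert r R"]) (use insert.hyps in force)+
  have "card {b. (a, b) \<in> R} \<le> card {b. (a, b) \<in> insert r R}" for a
    by (rule card_mono[OF finB]) auto
  moreover have "card {a. (a, b) \<in> R} \<le> card {a. (a, b) \<in> insert r R}" for b
    by (rule card_mono[OF finA]) auto
  ultimately obtain c where c: "line_proper R n c"
    using insert.IH insert.prems by (meson order_trans)
  have free: "\<exists>i<n. \<forall>x\<in>S. f x \<noteq> i" if "finite S" "card S < n" for S :: "'c set" and f :: "'c \<Rightarrow> nat"
  proof -
    have "\<not> {..<n} \<subseteq> f ` S"
      using that card_mono[of "f ` S" "{..<n}"] card_image_le[of S f] by auto
    then show ?thesis by blast
  qed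
  have "card {b. (a0, b) \<in> R} < card {b. (a0, b) \<in> insert r R}"
    by (rule psubset_card_mono[OF finB]) (use insert.hyps r in auto)
  with insert.prems(1)[of a0] have "card {b. (a0, b) \<in> R} < n" by simp
  moreover have "finite {b. (a0, b) \<in> R}" by (rule finite_subset[OF _ finB[of a0]]) auto
  ultimately obtain \<alpha> where \<alpha>: "\<alpha> < n" "\<And>b. (a0, b) \<in> R \<Longrightarrow> c (a0, b) \<noteq> \<alpha>"
    using free[of "{b. (a0, b) \<in> R}" "\<lambda>b. c (a0, b)"] by auto
  have "card {a. (a, b0) \<in> R} < card {a. (a, b0) \<in> insert r R}"
    by (rule psubset_card_mono[OF finA]) (use insert.hyps r in auto)
  with insert.prems(2)[of b0] have "card {a. (a, b0) \<in> R} < n" by simp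
  moreover have "finite {a. (a, b0) \<in> R}" by (rule finite_subset[OF _ finA[of b0]]) auto
  ultimately obtain \<beta> where \<beta>: "\<beta> < n" "\<And>a. (a, b0) \<in> R \<Longrightarrow> c (a, b0) \<noteq> \<beta>"
    using free[of "{a. (a, b0) \<in> R}" "\<lambda>a. c (a, b0)"] by auto
  obtain d where d: "line_proper R n d" "\<forall>b. (a0, b) \<in> R \<longrightarrow> d (a0, b) \<noteq> \<beta>"
      "\<forall>a. (a, b0) \<in> R \<longrightarrow> d (a, b0) \<noteq> \<beta>"
    using kempe_swap[OF c \<alpha>(1) \<beta>(1) \<alpha>(2) \<beta>(2)] by blast
  have "line_proper (insert r R) n (d(r := \<beta>))"
    using d \<beta>(1) insert.hyps(2) unfolding line_proper_def r by (auto simp: fun_upd_def) 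
  then show ?case by blast
qed

section \<open>Uniquely restricted matchings in bipartite graphs\<close>

text \<open>
  The edges of a bipartite graph are handled as pairs, whose first components lie in \<open>A\<close>.
\<close>

lemma bipartite_pairs:
  assumes V: "V = A \<union> B" "A \<inter> B = {}" "finite V"
    and E: "\<And>e. e \<in> E \<Longrightarrow> \<exists>a\<in>A. \<exists>b\<in>B. e = {a, b}"
    and R: "R = {(a, b). a \<in> A \<and> b \<in> B \<and> {a, b} \<in> E}"
    and deg: "max_degree V E \<le> d"
  shows "finite R" and "card {b. (a, b) \<in> R} \<le> d" and "card {a. (a, b) \<in> R} \<le> d"
proof -
  have "R \<subseteq> V \<times> V" using V R by auto
  then show "finite R" using \<open>finite V\<close> finite_subset by blast
  have "E \<subseteq> Pow V" using E V by blast
  then have finE: "finite E" using \<open>finite V\<close> finite_subset by blast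
  have vdeg: "card {e \<in> E. v \<in> e} \<le> d" if "v \<in> V" for v
  proof -
    have "vertex_degree E v \<le> max_degree V E"
      unfolding max_degree_def by (rule Max_ge) (use that \<open>finite V\<close> in auto)
    then show ?thesis using deg by (simp add: vertex_degree_def)
  qed
  show "card {b. (a, b) \<in> R} \<le> d"
  proof (cases "a \<in> A")
    case True
    have "card {b. (a, b) \<in> R} \<le> card {e \<in> E. a \<in> e}"
      by (rule card_inj_on_le[of "\<lambda>b. {a, b}"])
        (use R finE in \<open>auto simp: inj_on_def doubleton_eq_iff\<close>)
    then show ?thesis using vdeg[of a] True V by auto
  next
    case False
    then have "{b. (a, b) \<in> R} = {}" using R by auto
    then show ?thesis by simp
  qed
  show "card {a. (a, b) \<in> R} \<le> d"
  proof (cases "b \<in> B")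
    case True
    have "card {a. (a, b) \<in> R} \<le> card {e \<in> E. b \<in> e}"
      by (rule card_inj_on_le[of "\<lambda>a. {a, b}"])
        (use R finE in \<open>auto simp: inj_on_def doubleton_eq_iff\<close>)
    then show ?thesis using vdeg[of b] True V by auto
  next
    case False
    then have "{a. (a, b) \<in> R} = {}" using R by auto
    then show ?thesis by simp
  qed
qed

text \<open>
  All degrees inside a complete block of size \<open>d\<close> are exhausted, so no edge leaves the block and
  connectedness leaves no room for other vertices.
\<close>

lemma complete_block_is_whole_graph:
  assumes conn: "connected_graph V E" and V: "V = A \<union> B" "A \<inter> B = {}" "finite V"
    and E: "\<And>e. e \<in> E \<Longrightarrow> \<exists>a\<in>A. \<exists>b\<in>B. e = {a, b}"
    and R: "R = {(a, b). a \<in> A \<and> b \<in> B \<and> {a, b} \<in> E}" "finite R"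
    and row: "\<And>a. card {b. (a, b) \<in> R} \<le> d" and col: "\<And>b. card {a. (a, b) \<in> R} \<le> d"
    and XY: "X \<times> Y \<subseteq> R" "card X = d" "card Y = d" "d > 0"
  shows "X = A" and "Y = B"
proof -
  have fin: "finite X" "finite Y" using XY card.infinite by force+
  have ne: "X \<noteq> {}" "Y \<noteq> {}" using XY by auto
  have "{b. (a, b) \<in> R} = Y" if "a \<in> X" for a
  proof (rule sym, rule card_seteq)
    show "finite {b. (a, b) \<in> R}"
      by (rule finite_subset[of _ "snd ` R"]) (use R(2) in force)+
  qed (use XY that row in auto)
  then have r: "b \<in> Y" if "a \<in> X" "(a, b) \<in> R" for a b using that by blast
  have "{a. (a, b) \<in> R} = X" if "b \<in> Y" for b
  proof (rule sym, rule card_seteq)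
    show "finite {a. (a, b) \<in> R}"
      by (rule finite_subset[of _ "fst ` R"]) (use R(2) in force)+
  qed (use XY that col in auto)
  then have l: "a \<in> X" if "b \<in> Y" "(a, b) \<in> R" for a b using that by blast
  have sub: "X \<subseteq> A" "Y \<subseteq> B" using XY(1) ne R(1) by auto
  have closed: "v \<in> X \<union> Y" if uv: "u \<in> X \<union> Y" "{u, v} \<in> E" for u v
  proof -
    obtain a b where ab: "a \<in> A" "b \<in> B" "{u, v} = {a, b}" using E[OF uv(2)] by blast
    then have "(a, b) \<in> R" using uv(2) R(1) by simp
    then have "a \<in> X \<longleftrightarrow> b \<in> Y" using r l by blast
    moreover have "a \<notin> Y" "b \<notin> X" using ab sub V(2) by auto
    moreover have "u = a \<and> v = b \<or> u = b \<and> v = a" using ab(3) by (simp add: doubleton_eq_iff)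
    ultimately show ?thesis using uv(1) by blast
  qed
  obtain x where x: "x \<in> X" using ne by blast
  have "v \<in> X \<union> Y" if "v \<in> V" for v
  proof -
    have "(x, v) \<in> {(x, y). {x, y} \<in> E}\<^sup>*"
      using conn x sub V that unfolding connected_graph_def by blast
    then show ?thesis
      by (induction rule: rtrancl_induct) (use x closed in auto)
  qed
  then show "X = A" "Y = B" using sub V by blast+
qed

lemma complete_bipartite_isomorphic:
  assumes V: "V = A \<union> B" "A \<inter> B = {}" "finite V" "card A = m" "card B = n"
    and E: "\<And>e. e \<in> E \<Longrightarrow> \<exists>a\<in>A. \<exists>b\<in>B. e = {a, b}"
    and complete: "\<And>a b. a \<in> A \<Longrightarrow> b \<in> B \<Longrightarrow> {a, b} \<in> E"
  shows "graph_isomorphic V E (complete_bipartite_verts m n) (complete_bipartite_edges m n)"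
proof -
  obtain g where g: "bij_betw g A {..<m}"
    using V finite_same_card_bij[of A "{..<m}"] by auto
  obtain h where h: "bij_betw h B {..<n}"
    using V finite_same_card_bij[of B "{..<n}"] by auto
  define f where "f v = (if v \<in> A then Inl (g v) else Inr (h v))" for v
  have fA: "f a = Inl (g a)" "g a < m" if "a \<in> A" for a
    using that g by (auto simp: f_def bij_betw_def)
  have fB: "f b = Inr (h b)" "h b < n" if "b \<in> B" for b
    using that h V(2) by (auto simp: f_def bij_betw_def)
  have "bij_betw (Inl \<circ> g) A (Inl ` {..<m})"
    by (rule bij_betw_trans[OF g]) (simp add: bij_betw_def)
  then have "bij_betw f A (Inl ` {..<m})" by (subst bij_betw_cong[of A f "Inl \<circ> g"]) (auto simp: fA)
  moreover have "bij_betw (Inr \<circ> h) B (Inr ` {..<n})"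
    by (rule bij_betw_trans[OF h]) (simp add: bij_betw_def)
  then have "bij_betw f B (Inr ` {..<n})" by (subst bij_betw_cong[of B f "Inr \<circ> h"]) (auto simp: fB)
  ultimately have "bij_betw f V (complete_bipartite_verts m n)"
    unfolding V(1) complete_bipartite_verts_def Plus_def by (rule bij_betw_combine) auto
  moreover have "{u, v} \<in> E \<longleftrightarrow> {f u, f v} \<in> complete_bipartite_edges m n" if uv: "u \<in> V" "v \<in> V" for u v
  proof -
    have same: "{u, v} \<notin> E" if "u \<in> A \<and> v \<in> A \<or> u \<in> B \<and> v \<in> B"
    proof
      assume "{u, v} \<in> E"
      then obtain a b where "a \<in> A" "b \<in> B" "{u, v} = {a, b}" using E by blast
      then show False using that V(2) by (auto simp: doubleton_eq_iff)
    qed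
    consider "u \<in> A" "v \<in> A" | "u \<in> B" "v \<in> B" | "u \<in> A" "v \<in> B" | "u \<in> B" "v \<in> A"
      using uv V(1) by blast
    then show ?thesis
    proof cases
      case 1
      then show ?thesis using same by (auto simp: fA complete_bipartite_edges_def doubleton_eq_iff)
    next
      case 2
      then show ?thesis using same by (auto simp: fB complete_bipartite_edges_def doubleton_eq_iff)
    next
      case 3
      then show ?thesis using complete[of u v]
        by (auto simp: fA fB complete_bipartite_edges_def doubleton_eq_iff)
    next
      case 4
      then show ?thesis using complete[of v u]
        by (auto simp: fA fB complete_bipartite_edges_def doubleton_eq_iff insert_commute)
    qed
  qed
  ultimately show ?thesis unfolding graph_isomorphic_def by blast
qed

text \<open>
  Suppose that a matching \<open>M'\<close> covers the same vertices but misses an edge of \<open>N\<close>, and let \<open>m\<close> be a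
  missed edge with \<open>p m\<close> maximal. The edge that \<open>M'\<close> uses at the first end of \<open>m\<close> leads to the
  second end of some other \<open>n\<close> in \<open>N\<close>. Hence \<open>p n\<close> is larger, \<open>n\<close> belongs to \<open>M'\<close>, and \<open>M'\<close> has two edges at
  that second end. So \<open>M'\<close> contains \<open>N\<close>, and covering no further vertices it equals \<open>N\<close>.
\<close>

lemma acyclic_imp_uniquely_restricted:
  fixes p :: "'a \<times> 'a \<Rightarrow> int"
  assumes AB: "A \<inter> B = {}" and E: "\<And>e. e \<in> E \<Longrightarrow> \<exists>a\<in>A. \<exists>b\<in>B. e = {a, b}"
    and R: "R = {(a, b). a \<in> A \<and> b \<in> B \<and> {a, b} \<in> E}"
    and N: "N \<subseteq> R" "finite N"
    and fst_inj: "inj_on fst N" and snd_inj: "inj_on snd N"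
    and forward: "\<And>m n. \<lbrakk>m \<in> N; n \<in> N; m \<noteq> n; (fst m, snd n) \<in> R\<rbrakk> \<Longrightarrow> p m < p n"
  shows "uniquely_restricted E ((\<lambda>(a, b). {a, b}) ` N)"
proof -
  let ?f = "\<lambda>(a, b). {a, b}"
  have apart: "a \<noteq> b" if "a \<in> A" "b \<in> B" for a b using that AB by blast
  have NAB: "a \<in> A \<and> b \<in> B \<and> {a, b} \<in> E" if "(a, b) \<in> N" for a b using that N R by auto
  have "matching E (?f ` N)"
    unfolding matching_def
  proof
    show "?f ` N \<subseteq> E" using NAB by auto
    show "pairwise disjnt (?f ` N)"
    proof (rule pairwise_imageI)
      fix m n assume mn: "m \<in> N" "n \<in> N" "m \<noteq> n"
      obtain a b a' b' where eq: "m = (a, b)" "n = (a', b')" by (metis prod.exhaust)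
      have "fst m \<noteq> fst n" "snd m \<noteq> snd n"
        using mn inj_onD[OF fst_inj, of m n] inj_onD[OF snd_inj, of m n] by blast+
      then have "a \<noteq> a'" "b \<noteq> b'" unfolding eq by simp_all
      moreover have "a \<in> A" "b \<in> B" "a' \<in> A" "b' \<in> B" using NAB mn(1,2) unfolding eq by blast+
      then have "a \<noteq> b'" "b \<noteq> a'" using apart by metis+
      ultimately show "disjnt (?f m) (?f n)" using eq by (simp add: disjnt_def)
    qed
  qed
  moreover have "M' = ?f ` N" if M': "matching E M'" "\<Union>M' = \<Union>(?f ` N)" for M'
  proof -
    have ME: "M' \<subseteq> E" using M' by (simp add: matching_def)
    have meet: "e = e'" if "e \<in> M'" "e' \<in> M'" "x \<in> e" "x \<in> e'" for e e' x
      using that M'(1) unfolding matching_def pairwise_def disjnt_def by blast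
    have sub: "?f ` N \<subseteq> M'"
    proof (rule ccontr)
      assume "\<not> ?f ` N \<subseteq> M'"
      define S where "S = {m \<in> N. ?f m \<notin> M'}"
      have S: "S \<noteq> {}" "finite S" using \<open>\<not> ?f ` N \<subseteq> M'\<close> N(2) by (auto simp: S_def)
      then have "Max (p ` S) \<in> p ` S" by (intro Max_in) auto
      then obtain m where "m \<in> S" and Max: "p m = Max (p ` S)" by force
      then have m: "m \<in> N" "?f m \<notin> M'" by (simp_all add: S_def)
      have last: "?f n \<in> M'" if "n \<in> N" "p m < p n" for n
      proof (rule ccontr)
        assume "?f n \<notin> M'"
        then have "p n \<le> Max (p ` S)" using that S by (intro Max_ge) (auto simp: S_def)
        then show False using that Max by simp
      qed
      obtain a b where ab: "m = (a, b)" by force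
      have "a \<in> \<Union>(?f ` N)" using m(1) ab by force
      then obtain e where e: "e \<in> M'" "a \<in> e" using M'(2) by blast
      obtain a1 b1 where e1: "a1 \<in> A" "b1 \<in> B" "e = {a1, b1}" using E e ME by blast
      have "a \<in> A" using NAB m(1) ab by blast
      then have "e = {a, b1}" using e1 e(2) apart by auto
      have "b1 \<in> \<Union>(?f ` N)" using M'(2) e(1) e1(3) by blast
      then obtain n where n: "n \<in> N" "b1 \<in> ?f n" by blast
      obtain a2 b2 where n2: "n = (a2, b2)" by force
      then have "b2 = b1" using n NAB[of a2 b2] e1(2) apart by auto
      have "m \<noteq> n" using \<open>e = {a, b1}\<close> e(1) m(2) ab n2 \<open>b2 = b1\<close> by auto
      have "(fst m, snd n) \<in> R"
        using R ab n2 \<open>b2 = b1\<close> \<open>a \<in> A\<close> e1(2) \<open>e = {a, b1}\<close> e(1) ME by auto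
      then have "p m < p n" using forward m(1) n(1) \<open>m \<noteq> n\<close> by blast
      then have "?f n \<in> M'" by (rule last[OF n(1)])
      then have "?f n = e" using meet[of "?f n" e b1] n(2) e(1) e1(3) by blast
      then have "{a2, b1} = {a, b1}" using n2 \<open>b2 = b1\<close> \<open>e = {a, b1}\<close> by simp
      then have "a2 = a" by (auto simp: doubleton_eq_iff)
      then have "m = n" using inj_onD[OF fst_inj, of m n] ab n2 m(1) n(1) by simp
      then show False using \<open>m \<noteq> n\<close> by simp
    qed
    moreover have "e \<in> ?f ` N" if e: "e \<in> M'" for e
    proof -
      obtain x where "x \<in> e" using E ME e by blast
      then obtain e' where "e' \<in> ?f ` N" "x \<in> e'" using M'(2) e by blast
      then show ?thesis using meet[of e e' x] sub e \<open>x \<in> e\<close> by blast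
    qed
    ultimately show ?thesis by blast
  qed
  ultimately show ?thesis unfolding uniquely_restricted_def by blast
qed

lemma ur_chromatic_index_le_coloring:
  assumes "finite K" "finite E" and c: "\<And>e. e \<in> E \<Longrightarrow> c e \<in> K"
    and ur: "\<And>i. i \<in> K \<Longrightarrow> uniquely_restricted E {e \<in> E. c e = i}"
  shows "ur_chromatic_index E \<le> card K"
proof -
  define P where "P = (\<lambda>i. {e \<in> E. c e = i}) ` (c ` E)"
  have "partition_on E P"
    by (rule partition_onI) (auto simp: P_def disjnt_def)
  moreover have "finite P" using \<open>finite E\<close> by (simp add: P_def)
  moreover have "uniquely_restricted E M" if "M \<in> P" for M using that ur c by (auto simp: P_def)
  ultimately have "ur_chromatic_index E \<le> card P"
    unfolding ur_chromatic_index_def by (intro Least_le) blast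
  also have "\<dots> \<le> card (c ` E)" unfolding P_def using \<open>finite E\<close> by (intro card_image_le) auto
  also have "\<dots> \<le> card K" using c \<open>finite K\<close> by (intro card_mono) auto
  finally show ?thesis .
qed

text \<open>
  On the edges of a matching, put an arc from \<open>m\<close> to \<open>n\<close> when the first end of \<open>m\<close> is adjacent to
  the second end of \<open>n\<close>. The edge \<open>m\<close> itself uses up one of the at most \<open>d\<close> edges at each of its ends,
  which gives degrees at most \<open>d - 1\<close>; a complete digraph on \<open>d\<close> vertices would be a complete block
  of size \<open>d\<close>.
\<close>

lemma split_matching:
  fixes R :: "('a \<times> 'b) set"
  assumes "finite R" "d \<ge> 4"
    and row: "\<And>a. card {b. (a, b) \<in> R} \<le> d" and col: "\<And>b. card {a. (a, b) \<in> R} \<le> d"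
    and M: "M \<subseteq> R" "inj_on fst M" "inj_on snd M"
    and no_block: "\<And>X Y. card X = d \<Longrightarrow> card Y = d \<Longrightarrow> \<not> X \<times> Y \<subseteq> R"
  obtains c :: "'a \<times> 'b \<Rightarrow> nat" and p :: "'a \<times> 'b \<Rightarrow> int" where
    "\<And>m. m \<in> M \<Longrightarrow> c m < d - 1"
    "\<And>m n. \<lbrakk>m \<in> M; n \<in> M; m \<noteq> n; (fst m, snd n) \<in> R; c m = c n\<rbrakk> \<Longrightarrow> p m < p n"
proof -
  define arc where "arc m n \<longleftrightarrow> (fst m, snd n) \<in> R" for m n :: "'a \<times> 'b"
  have finM: "finite M" using M(1) \<open>finite R\<close> by (rule finite_subset)
  have out: "card {n \<in> M. n \<noteq> m \<and> arc m n} \<le> d - 1" if m: "m \<in> M" for m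
  proof -
    have "card {n \<in> M. n \<noteq> m \<and> arc m n} \<le> card ({b. (fst m, b) \<in> R} - {snd m})"
    proof (rule card_inj_on_le)
      show "inj_on snd {n \<in> M. n \<noteq> m \<and> arc m n}" using M(3) by (auto simp: inj_on_def)
      show "snd ` {n \<in> M. n \<noteq> m \<and> arc m n} \<subseteq> {b. (fst m, b) \<in> R} - {snd m}"
      proof (rule image_subsetI)
        fix n assume n: "n \<in> {n \<in> M. n \<noteq> m \<and> arc m n}"
        then have "snd n \<noteq> snd m" using inj_onD[OF M(3), of n m] m by auto
        then show "snd n \<in> {b. (fst m, b) \<in> R} - {snd m}"
          using n by (simp add: arc_def)
      qed
      show "finite ({b. (fst m, b) \<in> R} - {snd m})"
        by (rule finite_subset[of _ "snd ` R"]) (use \<open>finite R\<close> in force)+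
    qed
    also have "\<dots> = card {b. (fst m, b) \<in> R} - 1" using m M(1) by (intro card_Diff_singleton) auto
    also have "\<dots> \<le> d - 1" using row[of "fst m"] by simp
    finally show ?thesis .
  qed
  have inn: "card {n \<in> M. n \<noteq> m \<and> arc n m} \<le> d - 1" if m: "m \<in> M" for m
  proof -
    have "card {n \<in> M. n \<noteq> m \<and> arc n m} \<le> card ({a. (a, snd m) \<in> R} - {fst m})"
    proof (rule card_inj_on_le)
      show "inj_on fst {n \<in> M. n \<noteq> m \<and> arc n m}" using M(2) by (auto simp: inj_on_def)
      show "fst ` {n \<in> M. n \<noteq> m \<and> arc n m} \<subseteq> {a. (a, snd m) \<in> R} - {fst m}"
      proof (rule image_subsetI)
        fix n assume n: "n \<in> {n \<in> M. n \<noteq> m \<and> arc n m}"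
        then have "fst n \<noteq> fst m" using inj_onD[OF M(2), of n m] m by auto
        then show "fst n \<in> {a. (a, snd m) \<in> R} - {fst m}"
          using n by (simp add: arc_def)
      qed
      show "finite ({a. (a, snd m) \<in> R} - {fst m})"
        by (rule finite_subset[of _ "fst ` R"]) (use \<open>finite R\<close> in force)+
    qed
    also have "\<dots> = card {a. (a, snd m) \<in> R} - 1" using m M(1) by (intro card_Diff_singleton) auto
    also have "\<dots> \<le> d - 1" using col[of "snd m"] by simp
    finally show ?thesis .
  qed
  have block: "\<not> clique arc Q" if Q: "Q \<subseteq> M" "card Q = d - 1 + 1" for Q
  proof
    assume cl: "clique arc Q"
    have "card (fst ` Q) = card Q" "card (snd ` Q) = card Q"
      using inj_on_subset[OF M(2) Q(1)] inj_on_subset[OF M(3) Q(1)] by (simp_all add: card_image)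
    then have "card (fst ` Q) = d" "card (snd ` Q) = d" using Q(2) \<open>d \<ge> 4\<close> by auto
    moreover have "(fst m, snd n) \<in> R" if "m \<in> Q" "n \<in> Q" for m n
    proof (cases "m = n")
      case True
      then show ?thesis using that Q(1) M(1) by auto
    next
      case False
      then show ?thesis using cl that unfolding clique_def arc_def by blast
    qed
    then have "fst ` Q \<times> snd ` Q \<subseteq> R" by blast
    ultimately show False using no_block by blast
  qed
  have "d - 1 \<ge> 3" using \<open>d \<ge> 4\<close> by simp
  then show ?thesis
  proof (rule directed_brooks[OF finM _ out inn block])
    fix c :: "'a \<times> 'b \<Rightarrow> nat" and p :: "'a \<times> 'b \<Rightarrow> int"
    assume c: "\<And>m. m \<in> M \<Longrightarrow> c m < d - 1"
      and p: "\<And>m n. \<lbrakk>m \<in> M; n \<in> M; m \<noteq> n; arc m n; c m = c n\<rbrakk> \<Longrightarrow> p m < p n"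
    show thesis by (rule that[OF c p[unfolded arc_def]])
  qed
qed

theorem theorem4:
  fixes \<Delta> :: nat and V :: "'a set" and E :: "'a set set"
  assumes "\<Delta> \<ge> 4"
    and "simple_graph V E"
    and "connected_graph V E"
    and "bipartite_graph V E"
    and "max_degree V E \<le> \<Delta>"
    and "\<not> graph_isomorphic V E (complete_bipartite_verts \<Delta> \<Delta>) (complete_bipartite_edges \<Delta> \<Delta>)"
  shows "ur_chromatic_index E \<le> \<Delta>^2 - \<Delta>"
proof -
  from assms(4)[unfolded bipartite_graph_def] obtain A B where bipartite:
      "A \<union> B = V \<and> A \<inter> B = {} \<and> (\<forall>e\<in>E. \<exists>a\<in>A. \<exists>b\<in>B. e = {a, b})"
    by (elim exE) (rule that)
  then have AB: "V = A \<union> B" "A \<inter> B = {}" by simp_all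
  have E: "\<exists>a\<in>A. \<exists>b\<in>B. e = {a, b}" if "e \<in> E" for e using bipartite that by simp
  have finV: "finite V" using assms(2) by (simp add: simple_graph_def)
  define R where "R = {(a, b). a \<in> A \<and> b \<in> B \<and> {a, b} \<in> E}"
  note R = bipartite_pairs[OF AB finV E R_def assms(5)]
  have no_block: "\<not> X \<times> Y \<subseteq> R" if "card X = \<Delta>" "card Y = \<Delta>" for X Y
  proof
    assume "X \<times> Y \<subseteq> R"
    note whole = complete_block_is_whole_graph[OF assms(3) AB finV E R_def R this that]
    have "X = A" "Y = B" using whole \<open>\<Delta> \<ge> 4\<close> by simp_all
    then have "{a, b} \<in> E" if "a \<in> A" "b \<in> B" for a b
      using \<open>X \<times> Y \<subseteq> R\<close> that unfolding R_def by blast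
    then show False
      using complete_bipartite_isomorphic[OF AB finV _ _ E, of \<Delta> \<Delta>] assms(6) that
      unfolding \<open>X = A\<close> \<open>Y = B\<close> by simp
  qed
  obtain c where c: "line_proper R \<Delta> c" using koenig_edge_coloring[OF R] by blast
  define M where "M i = {r \<in> R. c r = i}" for i
  have Mi: "M i \<subseteq> R" "inj_on fst (M i)" "inj_on snd (M i)" for i
    using c unfolding M_def line_proper_def inj_on_def by force+
  have "\<exists>g. \<exists>p :: 'a \<times> 'a \<Rightarrow> int. (\<forall>m\<in>M i. g m < \<Delta> - 1) \<and>
      (\<forall>m\<in>M i. \<forall>n\<in>M i. m \<noteq> n \<longrightarrow> (fst m, snd n) \<in> R \<longrightarrow> g m = g n \<longrightarrow> p m < p n)" for i
    by (rule split_matching[OF R(1) \<open>\<Delta> \<ge> 4\<close> R(2,3) Mi[of i] no_block]) blast+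
  then obtain G and P :: "nat \<Rightarrow> 'a \<times> 'a \<Rightarrow> int" where
    G: "\<And>i m. m \<in> M i \<Longrightarrow> G i m < \<Delta> - 1" and
    P: "\<And>i m n. \<lbrakk>m \<in> M i; n \<in> M i; m \<noteq> n; (fst m, snd n) \<in> R; G i m = G i n\<rbrakk> \<Longrightarrow> P i m < P i n"
    by metis
  define f :: "'a \<times> 'a \<Rightarrow> 'a set" where "f = (\<lambda>(a, b). {a, b})"
  have "inj_on f R" using AB(2) by (auto simp: inj_on_def f_def R_def doubleton_eq_iff)
  define h where "h = the_inv_into R f"
  have hf: "h (f r) = r" if "r \<in> R" for r
    unfolding h_def using \<open>inj_on f R\<close> that by (rule the_inv_into_f_f)
  have fR: "E = f ` R" 
  proof
    show "E \<subseteq> f ` R"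
    proof
      fix e assume "e \<in> E"
      then obtain a b where "a \<in> A" "b \<in> B" "e = {a, b}" using E by blast
      then have "(a, b) \<in> R" "e = f (a, b)" using \<open>e \<in> E\<close> by (simp_all add: R_def f_def)
      then show "e \<in> f ` R" by blast
    qed
  qed (auto simp: R_def f_def)
  define color where "color e = (c (h e), G (c (h e)) (h e))" for e
  have "ur_chromatic_index E \<le> card ({..<\<Delta>} \<times> {..<\<Delta> - 1})"
  proof (rule ur_chromatic_index_le_coloring[of _ _ color])
    show "finite E" using R(1) fR by simp
    show "color e \<in> {..<\<Delta>} \<times> {..<\<Delta> - 1}" if e: "e \<in> E" for e
    proof -
      obtain r where r: "r \<in> R" "e = f r" using e fR by blast
      have "c r < \<Delta>" using c r(1) unfolding line_proper_def by (cases r) blast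
      moreover have "G (c r) r < \<Delta> - 1" using G[of r "c r"] r(1) by (simp add: M_def)
      ultimately show ?thesis using r hf by (simp add: color_def)
    qed
    show "uniquely_restricted E {e \<in> E. color e = ij}" for ij
    proof -
      obtain i j where ij: "ij = (i, j)" by force
      define N where "N = {r \<in> M i. G i r = j}"
      have "{e \<in> E. color e = ij} = f ` N"
        unfolding fR ij N_def M_def color_def using hf by auto
      moreover have "N \<subseteq> M i" by (auto simp: N_def)
      then have "uniquely_restricted E (f ` N)"
        unfolding f_def
      proof (intro acyclic_imp_uniquely_restricted[OF AB(2) E R_def, of N "P i"])
        show "N \<subseteq> R" using \<open>N \<subseteq> M i\<close> Mi(1) by blast
        then show "finite N" using R(1) by (rule finite_subset)
        show "inj_on fst N" "inj_on snd N" using Mi(2,3) \<open>N \<subseteq> M i\<close> inj_on_subset by blast+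
        show "P i m < P i n" if "m \<in> N" "n \<in> N" "m \<noteq> n" "(fst m, snd n) \<in> R" for m n
          using that P[of m i n] by (simp add: N_def)
      qed
      ultimately show ?thesis by simp
    qed
  qed simp
  also have "\<dots> = \<Delta>\<^sup>2 - \<Delta>" by (simp add: power2_eq_square diff_mult_distrib2)
  finally show ?thesis .
qed

end
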